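(* Let $q\in\mathbb{R}$ with $q>0$ and $q\ne1$, and let $\alpha,\beta>-1$. For every integer $n\ge2$ there exists a $q$-difference equation of the form $$(1-x^2)\,D_{q,x}^2y(x)+\left[\beta-\alpha-(\alpha+\beta+2)x\right]D_{q,x}y(x)+[n]_q\left([n-1]_q+\alpha+\beta+2\right)y(x)=0$$ with polynomial solution $y_{J,m_q}(x)=\sum_{\nu=0}^na_\nu x^\nu$ defined, from the initial coefficients $a_0,a_1$, by $$a_2=-\frac{(\beta-\alpha)a_1+[n]_q\left([n-1]_q+\alpha+\beta+2\right)a_0}{[2]_q},$$ $$a_3=\frac{\left[\alpha+\beta+2+(\beta-\alpha)^2-[n]_q\left([n-1]_q+\alpha+\beta+2\right)\right]a_1+[n]_q\left([n-1]_q+\alpha+\beta+2\right)(\beta-\alpha)a_0}{[3]_q[2]_q},$$ and $$a_{\nu+2}=\frac{[\nu]_q\left([\nu-1]_q+\alpha+\beta+2\right)-[n]_q\left([n-1]_q+\alpha+\beta+2\right)}{[\nu+2]_q[\nu+1]_q}a_\nu-\frac{\beta-\alpha}{[\nu+2]_q}a_{\nu+1}$$ for every $\nu\ge2$.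
   Context: $[j]_q=\frac{1-q^j}{1-q}$ for integers $j\ge0$. $D_{q,x}$ is the Jackson $q$-derivative $D_{q,x}f(x)=\frac{f(qx)-f(x)}{qx-x}$, which acts on polynomials by $D_{q,x}1=0$, $D_{q,x}x^k=[k]_qx^{k-1}$ for $k\ge1$; $D_{q,x}^2=D_{q,x}\circ D_{q,x}$. The subscript $m_q$ in the name $y_{J,m_q}$ refers to the sequence of $q$-factorials $m_q=([p]_q!)_{p\ge0}$, with $[0]_q!=1$ and $[p]_q!=[p]_q[p-1]_q\cdots[1]_q$. *)

theory Defs
  imports "HOL-Analysis.Analysis"
begin

definition qint :: "real \<Rightarrow> nat \<Rightarrow> real" where
  "qint q j = (1 - q ^ j) / (1 - q)"

text \<open>
  The quotient is undefined at \<open>x = 0\<close>. There the usual convention is the ordinary derivative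
  of \<open>f\<close> at 0, which is what makes the rule for powers below (and hence, by linearity, for
  all polynomials) hold on the whole real line.
\<close>

definition jackson :: "real \<Rightarrow> (real \<Rightarrow> real) \<Rightarrow> real \<Rightarrow> real" where
  "jackson q f x = (if x = 0 then deriv f 0 else (f (q * x) - f x) / (q * x - x))"

lemma jackson_sum:
  assumes "finite A" and "\<And>i. i \<in> A \<Longrightarrow> f i field_differentiable (at 0)"
  shows "jackson q (\<lambda>x. \<Sum>i\<in>A. c i * f i x) = (\<lambda>x. \<Sum>i\<in>A. c i * jackson q (f i) x)"
proof
  fix x
  have "((\<lambda>x. \<Sum>i\<in>A. c i * f i x) has_field_derivative (\<Sum>i\<in>A. c i * deriv (f i) 0)) (at 0)"
    using assms by (intro DERIV_sum DERIV_cmult) (simp add: field_differentiable_derivI)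
  then show "jackson q (\<lambda>x. \<Sum>i\<in>A. c i * f i x) x = (\<Sum>i\<in>A. c i * jackson q (f i) x)"
    by (simp add: jackson_def DERIV_imp_deriv sum_subtractf [symmetric] sum_divide_distrib
        right_diff_distrib [symmetric])
qed

lemma jackson_const: "jackson q (\<lambda>x. c) = (\<lambda>x. 0)"
  by (simp add: jackson_def fun_eq_iff)

lemma jackson_power:
  assumes "q \<noteq> 1" and "k \<ge> 1"
  shows "jackson q (\<lambda>x. x ^ k) = (\<lambda>x. qint q k * x ^ (k - 1))"
proof
  fix x :: real
  obtain m where k: "k = Suc m" using assms(2) by (cases k) auto
  show "jackson q (\<lambda>x. x ^ k) x = qint q k * x ^ (k - 1)"
  proof (cases "x = 0")
    case True
    have "((\<lambda>x::real. x ^ k) has_field_derivative real k * 0 ^ (k - 1)) (at 0)"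
      by (auto intro!: derivative_eq_intros)
    then have "deriv (\<lambda>x::real. x ^ k) 0 = real k * 0 ^ (k - 1)"
      by (rule DERIV_imp_deriv)
    then show ?thesis
      using True assms(1) by (cases m) (simp_all add: k jackson_def qint_def)
  next
    case False
    then have "q * x - x \<noteq> 0" using assms(1) by simp
    moreover have "1 - q \<noteq> 0" using assms(1) by simp
    ultimately show ?thesis
      using False by (simp add: k jackson_def qint_def field_simps power_mult_distrib)
  qed
qed

end

theory Submission imports Defs begin

text \<open>
  Put \<open>\<lambda>\<^sub>\<nu> = [\<nu>] ([\<nu> - 1] + \<alpha> + \<beta> + 2)\<close>. Comparing coefficients of \<open>x\<^sup>\<nu>\<close>, a polynomial
  \<open>\<Sum> a\<^sub>\<nu> x\<^sup>\<nu>\<close> of degree at most \<open>n\<close> solves the equation iff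
  \<open>[\<nu> + 2] [\<nu> + 1] a\<^bsub>\<nu> + 2\<^esub> + (\<beta> - \<alpha>) [\<nu> + 1] a\<^bsub>\<nu> + 1\<^esub> + (\<lambda>\<^sub>n - \<lambda>\<^sub>\<nu>) a\<^sub>\<nu> = 0\<close> for all \<open>\<nu>\<close>, and the
  formulas for \<open>a\<^sub>2\<close>, \<open>a\<^sub>3\<close> and \<open>a\<^bsub>\<nu> + 2\<^esub>\<close> are this relation solved for its top coefficient.
  Since \<open>\<lambda>\<close> is strictly increasing, the relation can instead be solved downwards from \<open>a\<^sub>n = 1\<close>
  and \<open>a\<^sub>\<nu> = 0\<close> for \<open>\<nu> > n\<close>; the relation at \<open>\<nu> = n\<close> holds because its last factor vanishes.
\<close>

lemma qint_0 [simp]: "qint q 0 = 0"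
  by (simp add: qint_def)

lemma qint_eq_sum:
  assumes "q \<noteq> 1"
  shows "qint q j = (\<Sum>i<j. q ^ i)"
  using assms by (simp add: qint_def sum_gp_strict)

lemma qint_1 [simp]: "q \<noteq> 1 \<Longrightarrow> qint q (Suc 0) = 1"
  by (simp add: qint_eq_sum)

lemma qint_strict_mono:
  assumes "q > 0" and "q \<noteq> 1"
  shows "strict_mono (qint q)"
  using assms by (intro strict_mono_Suc_iff [THEN iffD2]) (simp add: qint_eq_sum)

lemma qint_pos:
  assumes "q > 0" and "q \<noteq> 1" and "j > 0"
  shows "qint q j > 0"
  using strict_monoD [OF qint_strict_mono [OF assms(1,2)] assms(3)] by simp

text \<open>Makes the divisor in the downward recursion nonzero. Only the first factor increases
  strictly: truncated subtraction gives the second the value \<open>c\<close> at both 0 and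
  1.\<close>

lemma eigenvalue_less:
  assumes "q > 0" and "q \<noteq> 1" and "c > 0" and "k < n"
  shows "qint q k * (qint q (k - 1) + c) < qint q n * (qint q (n - 1) + c)"
proof (rule mult_less_le_imp_less)
  note sm = qint_strict_mono [OF assms(1,2)]
  show "qint q k < qint q n"
    using sm assms(4) by (rule strict_monoD)
  show "qint q (k - 1) + c \<le> qint q (n - 1) + c"
    using assms(4) by (simp add: strict_mono_less_eq [OF sm])
  have nonneg: "qint q j \<ge> 0" for j
    using strict_mono_less_eq [OF sm, of 0 j] by simp
  show "0 \<le> qint q k"
    by (rule nonneg)
  show "0 < qint q (k - 1) + c"
    using nonneg [of "k - 1"] assms(3) by simp
qed

text \<open>Induction on the top index: dropping index 0 shifts the coefficient sequences, so
  \<open>c\<close> and \<open>d\<close> must be arbitrary; the missing value is then prepended by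
  \<open>case_nat\<close>.\<close>

lemma ex_downward_recurrence:
  fixes c d :: "nat \<Rightarrow> 'a::comm_semiring_1"
  shows "\<exists>a. a n = 1 \<and> (\<forall>k>n. a k = 0) \<and>
    (\<forall>k<n. a k = c k * a (Suc k) + d k * a (Suc (Suc k)))"
proof (induction n arbitrary: c d)
  case 0
  show ?case
    by (rule exI [of _ "\<lambda>k. if k = 0 then 1 else 0"]) simp
next
  case (Suc n)
  from Suc.IH [of "\<lambda>k. c (Suc k)" "\<lambda>k. d (Suc k)"] obtain a where a: "a n = 1" "\<forall>k>n. a k = 0"
    "\<forall>k<n. a k = c (Suc k) * a (Suc k) + d (Suc k) * a (Suc (Suc k))"
    by blast
  show ?case
    by (rule exI [of _ "case_nat (c 0 * a 0 + d 0 * a 1) a"])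
      (use a in \<open>auto split: nat.split\<close>)
qed

text \<open>The vanishing end coefficients keep the summation range at \<open>n\<close> although the
  degree is shifted, so that all terms of the equation can be added coefficientwise.\<close>

lemma sum_shift_times:
  fixes c :: "nat \<Rightarrow> 'a::comm_semiring_1"
  assumes "c 0 = 0" and "c (Suc n) = 0"
  shows "x * (\<Sum>k\<le>n. c (Suc k) * x ^ k) = (\<Sum>k\<le>n. c k * x ^ k)"
proof -
  have "x * (\<Sum>k\<le>n. c (Suc k) * x ^ k) = (\<Sum>k\<le>n. c (Suc k) * x ^ Suc k)"
    by (simp add: sum_distrib_left mult_ac)
  also have "\<dots> = (\<Sum>k\<le>Suc n. c k * x ^ k)"
    unfolding sum.atMost_Suc_shift using assms(1) by simp
  finally show ?thesis
    using assms(2) by simp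
qed

text \<open>The range again stays at \<open>n\<close> instead of dropping by one: the new top
  coefficient is zero, and the lemma can be applied twice with the same \<open>n\<close>.\<close>

lemma jackson_poly:
  assumes "q \<noteq> 1" and "c (Suc n) = 0"
  shows "jackson q (\<lambda>x. \<Sum>k\<le>n. c k * x ^ k) = (\<lambda>x. \<Sum>k\<le>n. qint q (Suc k) * c (Suc k) * x ^ k)"
proof -
  have "jackson q (\<lambda>x. \<Sum>k\<le>n. c k * x ^ k) = (\<lambda>x. \<Sum>k\<le>n. c k * jackson q (\<lambda>x. x ^ k) x)"
    by (rule jackson_sum) (auto intro!: derivative_intros)
  also have "\<dots> = (\<lambda>x. \<Sum>k\<le>Suc n. c k * jackson q (\<lambda>x. x ^ k) x)"
    using assms(2) by simp
  also have "\<dots> = (\<lambda>x. \<Sum>k\<le>n. qint q (Suc k) * c (Suc k) * x ^ k)"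
    unfolding sum.atMost_Suc_shift using assms(1)
    by (simp add: jackson_const jackson_power mult_ac del: power_Suc)
  finally show ?thesis .
qed

lemma q_hypergeometric_poly:
  fixes a :: "nat \<Rightarrow> real"
  assumes "q \<noteq> 1" and "\<And>k. k > n \<Longrightarrow> a k = 0"
    and rec: "\<And>k. qint q (k + 2) * qint q (k + 1) * a (k + 2) + b * qint q (k + 1) * a (k + 1)
      + (l - qint q k * (qint q (k - 1) + c)) * a k = 0"
    and y: "y = (\<lambda>x. \<Sum>k\<le>n. a k * x ^ k)"
  shows "(1 - x\<^sup>2) * jackson q (jackson q y) x + (b - c * x) * jackson q y x + l * y x = 0"
proof -
  have D1: "jackson q y = (\<lambda>x. \<Sum>k\<le>n. qint q (Suc k) * a (Suc k) * x ^ k)"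
    unfolding y by (rule jackson_poly) (use assms in auto)
  have D2: "jackson q (jackson q y) =
      (\<lambda>x. \<Sum>k\<le>n. qint q (Suc k) * (qint q (Suc (Suc k)) * a (Suc (Suc k))) * x ^ k)"
    unfolding D1
    by (rule jackson_poly [where c = "\<lambda>k. qint q (Suc k) * a (Suc k)"]) (use assms in auto)
  have xD1: "x * jackson q y x = (\<Sum>k\<le>n. qint q k * a k * x ^ k)"
    unfolding D1 by (rule sum_shift_times) (use assms in auto)
  have "x * jackson q (jackson q y) x = (\<Sum>k\<le>n. qint q k * (qint q (Suc k) * a (Suc k)) * x ^ k)"
    unfolding D2
    by (rule sum_shift_times [where c = "\<lambda>k. qint q k * (qint q (Suc k) * a (Suc k))"])
      (use assms in auto)
  \<comment> \<open>At \<open>k = 0\<close> the index \<open>k - 1\<close> is truncated, but the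
    factor \<open>qint q k\<close> is zero there.\<close>
  also have "x * \<dots> = (\<Sum>k\<le>n. qint q (k - 1) * (qint q k * a k) * x ^ k)"
    using sum_shift_times [where c = "\<lambda>k. qint q (k - 1) * (qint q k * a k)" and n = n and x = x]
      assms by simp
  finally have xxD2: "x\<^sup>2 * jackson q (jackson q y) x =
      (\<Sum>k\<le>n. qint q (k - 1) * (qint q k * a k) * x ^ k)"
    by (simp add: power2_eq_square mult.assoc)
  have "(1 - x\<^sup>2) * jackson q (jackson q y) x + (b - c * x) * jackson q y x + l * y x =
      jackson q (jackson q y) x - x\<^sup>2 * jackson q (jackson q y) x + b * jackson q y x
      - c * (x * jackson q y x) + l * y x"
    by (simp add: algebra_simps)
  also have "\<dots> = (\<Sum>k\<le>n. (qint q (k + 2) * qint q (k + 1) * a (k + 2)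
      + b * qint q (k + 1) * a (k + 1) + (l - qint q k * (qint q (k - 1) + c)) * a k) * x ^ k)"
    unfolding xxD2 xD1 unfolding D2 unfolding D1 unfolding y
    by (simp add: sum_distrib_left sum.distrib [symmetric] sum_subtractf [symmetric] algebra_simps)
  finally show ?thesis
    by (simp only: rec mult_zero_left sum.neutral_const)
qed

theorem corollary7:
  fixes q \<alpha> \<beta> :: real and n :: nat
  assumes "q > 0" and "q \<noteq> 1" and "\<alpha> > -1" and "\<beta> > -1" and "n \<ge> 2"
  shows "\<exists>(a :: nat \<Rightarrow> real) (y :: real \<Rightarrow> real).
    a 2 = - (((\<beta> - \<alpha>) * a 1 + qint q n * (qint q (n - 1) + \<alpha> + \<beta> + 2) * a 0) / qint q 2) \<and>
    a 3 = ((\<alpha> + \<beta> + 2 + (\<beta> - \<alpha>)\<^sup>2 - qint q n * (qint q (n - 1) + \<alpha> + \<beta> + 2)) * a 1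
           + qint q n * (qint q (n - 1) + \<alpha> + \<beta> + 2) * (\<beta> - \<alpha>) * a 0) / (qint q 3 * qint q 2) \<and>
    (\<forall>\<nu>\<ge>2. a (\<nu> + 2) =
       (qint q \<nu> * (qint q (\<nu> - 1) + \<alpha> + \<beta> + 2) - qint q n * (qint q (n - 1) + \<alpha> + \<beta> + 2))
         / (qint q (\<nu> + 2) * qint q (\<nu> + 1)) * a \<nu>
       - (\<beta> - \<alpha>) / qint q (\<nu> + 2) * a (\<nu> + 1)) \<and>
    y = (\<lambda>x. \<Sum>\<nu>=0..n. a \<nu> * x ^ \<nu>) \<and> a n \<noteq> 0 \<and>
    (\<forall>x. (1 - x\<^sup>2) * jackson q (jackson q y) x
          + (\<beta> - \<alpha> - (\<alpha> + \<beta> + 2) * x) * jackson q y x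
          + qint q n * (qint q (n - 1) + \<alpha> + \<beta> + 2) * y x = 0)"
proof -
  define b where "b = \<beta> - \<alpha>"
  define c where "c = \<alpha> + \<beta> + 2"
  define l where "l = (\<lambda>k. qint q k * (qint q (k - 1) + c))"
  have c: "c > 0"
    using assms by (simp add: c_def)
  have l_less: "l k < l n" if "k < n" for k
    unfolding l_def using assms(1,2) c that by (rule eigenvalue_less)
  have pos: "qint q (Suc k) > 0" for k
    using assms(1,2) by (simp add: qint_pos)
  obtain a where a_n: "a n = 1" and a_0: "\<And>k. k > n \<Longrightarrow> a k = 0"
    and a_less: "\<And>k. k < n \<Longrightarrow> a k = - (b * qint q (k + 1) / (l n - l k)) * a (Suc k)
      + - (qint q (k + 2) * qint q (k + 1) / (l n - l k)) * a (Suc (Suc k))"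
    using ex_downward_recurrence [of n "\<lambda>k. - (b * qint q (k + 1) / (l n - l k))"
      "\<lambda>k. - (qint q (k + 2) * qint q (k + 1) / (l n - l k))"] by blast
  have rec: "qint q (k + 2) * qint q (k + 1) * a (k + 2) + b * qint q (k + 1) * a (k + 1)
      + (l n - l k) * a k = 0" for k
  proof (cases k n rule: linorder_cases)
    case less
    \<comment> \<open>Clears the denominators. The instance below contains the right-hand side of
      \<open>a_less\<close> literally, so it can be folded into \<open>a k\<close>.\<close>
    have "(l n - l k) * (- (u / (l n - l k)) * s + - (v / (l n - l k)) * t) = - (u * s) - v * t"
      for u v s t
      using l_less [OF less] by (simp add: right_diff_distrib [of "l n - l k"])
    from this [of "b * qint q (k + 1)" "a (Suc k)" "qint q (k + 2) * qint q (k + 1)"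
        "a (Suc (Suc k))", folded a_less [OF less]]
    show ?thesis
      by simp
  \<comment> \<open>For \<open>k = n\<close> the factor \<open>l n - l k\<close> vanishes; all other
    coefficients involved have index above \<open>n\<close>.\<close>
  qed (simp_all add: a_0)
  \<comment> \<open>Valid for every \<open>k\<close>: the cases 0 and 1 yield the separate formulas
    for \<open>a 2\<close> and \<open>a 3\<close>.\<close>
  have up: "a (k + 2) = (l k - l n) / (qint q (k + 2) * qint q (k + 1)) * a k
      - b / qint q (k + 2) * a (k + 1)" for k
  proof -
    have "qint q (k + 2) * qint q (k + 1) * a (k + 2) = (l k - l n) * a k - b * qint q (k + 1) * a (k + 1)"
      using rec [of k] by (simp add: algebra_simps)
    then have "a (k + 2) =
        ((l k - l n) * a k - b * qint q (k + 1) * a (k + 1)) / (qint q (k + 2) * qint q (k + 1))"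
      using pos [of k] pos [of "Suc k"] by (simp add: eq_divide_eq mult_ac)
    then show ?thesis
      using pos [of k] by (simp add: diff_divide_distrib left_diff_distrib)
  qed
  have l_0: "l 0 = 0" and l_1: "l 1 = c"
    using assms(2) by (simp_all add: l_def)
  have a_2: "a 2 = - ((b * a 1 + l n * a 0) / qint q 2)"
    using up [of 0] assms(2) by (simp add: l_0 numeral_2_eq_2 diff_divide_distrib add_divide_distrib)
  have "a 3 = ((c - l n) * a 1 - b * qint q 2 * a 2) / (qint q 3 * qint q 2)"
    using up [of 1] pos [of 1] l_1
    by (simp add: numeral_2_eq_2 numeral_3_eq_3 diff_divide_distrib left_diff_distrib)
  \<comment> \<open>Eliminating \<open>a 2\<close> in favour of \<open>a 0\<close> and
    \<open>a 1\<close> produces the square of \<open>b\<close>.\<close>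
  also have "b * qint q 2 * a 2 = - b * (b * a 1 + l n * a 0)"
    unfolding a_2 using pos [of 1] by (simp add: numeral_2_eq_2)
  finally have a_3: "a 3 = ((c + b\<^sup>2 - l n) * a 1 + l n * b * a 0) / (qint q 3 * qint q 2)"
    by (simp add: algebra_simps power2_eq_square)
  define y where "y = (\<lambda>x. \<Sum>k\<le>n. a k * x ^ k)"
  have eqn: "(1 - x\<^sup>2) * jackson q (jackson q y) x + (b - c * x) * jackson q y x + l n * y x = 0" for x
    by (rule q_hypergeometric_poly [where a = a])
      (use assms(2) a_0 rec y_def in \<open>auto simp: l_def\<close>)
  show ?thesis
  proof (intro exI conjI allI impI)
    show "y = (\<lambda>x. \<Sum>\<nu>=0..n. a \<nu> * x ^ \<nu>)"
      by (simp add: y_def atLeast0AtMost)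
    show "a n \<noteq> 0"
      by (simp add: a_n)
  qed (use a_2 a_3 up eqn in \<open>simp_all add: b_def c_def l_def add.assoc\<close>)
qed

end
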